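(* Let $G$ be a compact (not necessarily connected) Abelian group, $(\Omega,\mu)$ a measure space, $A:\Omega\to\mathrm{Aut}(G)$ a measurable map, and $\Phi$ a locally $\mu$-integrable function on $\Omega$. Suppose that one of the following two conditions holds: 1) $G$ is first-countable; 2) $\Omega$ is a completely regular topological space with a bounded Radon measure $\mu$, $\Phi$ is a bounded and continuous function on $\Omega$, and the map $\Omega\times G\to G$, $(u,x)\mapsto A(u)(x)$ is continuous. Then the Hausdorff operator $\mathcal{H}_{\Phi,A}$ acts in the space $C(G)$ and is bounded if and only if $\Phi\in L^1(\mu)$, and in this case $\|\mathcal{H}_{\Phi,A}\|\le\|\Phi\|_{L^1(\mu)}$.
   Context: $\mathrm{Aut}(G)$ is the group of topological automorphisms of $G$ with its natural topology. $C(G)$ is the space of continuous functions on $G$ with the supremum norm. The Hausdorff operator is $(\mathcal{H}_{\Phi,A}f)(x)=\int_\Omega\Phi(u)f(A(u)(x))\,d\mu(u)$. It acts in $C(G)$ if for every $f\in C(G)$ the (Lebesgue) integral exists for every $x\in G$ and defines a function in $C(G)$; $\|\mathcal{H}_{\Phi,A}\|$ is the operator norm on $C(G)$. *)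

theory Defs
  imports "HOL-Analysis.Analysis"
begin

definition Aut :: "('g \<Rightarrow> 'g :: topological_ab_group_add) set" where
  "Aut = {\<tau>. (\<forall>x y. \<tau> (x + y) = \<tau> x + \<tau> y) \<and> homeomorphic_map euclidean euclidean \<tau>}"

text \<open>The natural (Braconnier) topology on the automorphism group: the coarsest topology for which
  both \<open>\<tau>\<close> and \<open>inv \<tau>\<close> depend continuously on \<open>\<tau>\<close> with respect to the compact-open topology.
  Its underlying set is \<open>Aut\<close>, because \<open>K = {}\<close> is allowed.\<close>

definition Aut_topology :: "('g \<Rightarrow> 'g :: topological_ab_group_add) topology" where
  "Aut_topology = topology_generated_by
     ({{\<tau> \<in> Aut. \<tau> ` K \<subseteq> U} |K U. compact K \<and> open U} \<union>
      {{\<tau> \<in> Aut. inv \<tau> ` K \<subseteq> U} |K U. compact K \<and> open U})"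

definition borel_of :: "'a topology \<Rightarrow> 'a measure" where
  "borel_of T = sigma (topspace T) {U. openin T U}"

definition bounded_Radon_measure :: "'w topology \<Rightarrow> 'w measure \<Rightarrow> bool" where
  "bounded_Radon_measure T M \<longleftrightarrow>
     space M = topspace T \<and> sets M = sets (borel_of T) \<and> finite_measure M \<and>
     (\<forall>B \<in> sets M. emeasure M B =
        (SUP K \<in> {K \<in> sets M. compactin T K \<and> K \<subseteq> B}. emeasure M K))"

text \<open>No topology is available on a general measure space, so local integrability refers to
  the measurable sets of finite measure.\<close>

definition locally_integrable :: "'w measure \<Rightarrow> ('w \<Rightarrow> complex) \<Rightarrow> bool" where
  "locally_integrable M \<Phi> \<longleftrightarrow>
     \<Phi> \<in> borel_measurable M \<and>
     (\<forall>S \<in> sets M. emeasure M S < \<infinity> \<longrightarrow> set_integrable M S \<Phi>)"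

definition hausdorff_op ::
  "'w measure \<Rightarrow> ('w \<Rightarrow> complex) \<Rightarrow> ('w \<Rightarrow> 'g \<Rightarrow> 'g) \<Rightarrow> ('g \<Rightarrow> complex) \<Rightarrow> 'g \<Rightarrow> complex" where
  "hausdorff_op M \<Phi> A f x = (LINT u|M. \<Phi> u * f (A u x))"

definition hausdorff_acts_in_C ::
  "'w measure \<Rightarrow> ('w \<Rightarrow> complex) \<Rightarrow> ('w \<Rightarrow> 'g \<Rightarrow> 'g :: topological_space) \<Rightarrow> bool" where
  "hausdorff_acts_in_C M \<Phi> A \<longleftrightarrow>
     (\<forall>f. continuous_on UNIV f \<longrightarrow>
        (\<forall>x. integrable M (\<lambda>u. \<Phi> u * f (A u x))) \<and> continuous_on UNIV (hausdorff_op M \<Phi> A f))"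

text \<open>On a compact space every continuous function is bounded, so the type of bounded continuous
  functions with its supremum norm is the space of all continuous functions. The following
  operator is meaningful only if \<^const>\<open>hausdorff_acts_in_C\<close> holds; otherwise
  \<^const>\<open>Bcontfun\<close> may be applied to a function that is not continuous.\<close>

definition hausdorff_C ::
  "'w measure \<Rightarrow> ('w \<Rightarrow> complex) \<Rightarrow> ('w \<Rightarrow> 'g \<Rightarrow> 'g) \<Rightarrow>
   ('g :: topological_space \<Rightarrow>\<^sub>C complex) \<Rightarrow> ('g \<Rightarrow>\<^sub>C complex)" where
  "hausdorff_C M \<Phi> A f = Bcontfun (hausdorff_op M \<Phi> A (apply_bcontfun f))"

end

theory Submission
  imports Defs
begin

text \<open>
  Testing the operator on the constant function \<open>1\<close> shows that integrability of \<open>\<Phi>\<close> is necessary.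
  Conversely, let \<open>\<Phi>\<close> be integrable and \<open>f\<close> continuous, hence bounded. The integrand
  \<open>\<Phi> u * f (A u x)\<close> is measurable in \<open>u\<close>, because evaluation at \<open>x\<close> is continuous for the topology
  of the automorphism group, and it is dominated by a multiple of \<open>norm (\<Phi> u)\<close>. So the integral
  exists, and the norm estimate follows from the pointwise bound
  \<open>norm (\<Phi> u * f (A u x)) \<le> norm (\<Phi> u) * norm f\<close>.

  What remains is the continuity of the integral in the parameter \<open>x\<close>. Dominated convergence is a
  theorem on sequences and fails for nets, and this is why one of two additional conditions is
  imposed. In a first-countable group sequences suffice
  (\<open>continuous_on_integral_first_countable\<close>). In the second case the measure is concentrated, up to
  an arbitrarily small mass, on a compact set \<open>K\<close>. The tube lemma makes the integrand vary little in
  \<open>x\<close> uniformly for \<open>u \<in> K\<close>, and the rest contributes little, since the integrand is bounded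
  (\<open>continuous_on_integral_bounded_Radon\<close>).
\<close>

section \<open>Continuity of parameter integrals\<close>

lemma norm_integral_le_integral:
  fixes f :: "'a \<Rightarrow> 'b::{banach, second_countable_topology}"
  assumes f: "integrable M f" and g: "integrable M g"
    and le: "\<And>x. x \<in> space M \<Longrightarrow> norm (f x) \<le> g x"
  shows "norm (LINT x|M. f x) \<le> (LINT x|M. g x)"
  using integral_norm_bound integral_mono[OF integrable_norm[OF f] g le] by (rule order_trans)

text \<open>If continuity failed at \<open>x\<close>, a decreasing countable neighbourhood base of \<open>x\<close> would yield a
  sequence that tends to \<open>x\<close> and along which the integrals stay away from the one at \<open>x\<close>,
  in contradiction to dominated convergence.\<close>

lemma continuous_on_integral_first_countable:
  fixes g :: "'x::topological_space \<Rightarrow> 'w \<Rightarrow> 'b::{banach, second_countable_topology}"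
  assumes fc: "first_countable (euclidean :: 'x topology)"
    and meas: "\<And>x. g x \<in> borel_measurable M"
    and cont: "\<And>u. u \<in> space M \<Longrightarrow> continuous_on UNIV (\<lambda>x. g x u)"
    and w: "integrable M w"
    and bound: "\<And>x u. u \<in> space M \<Longrightarrow> norm (g x u) \<le> w u"
  shows "continuous_on UNIV (\<lambda>x. LINT u|M. g x u)"
proof -
  let ?F = "\<lambda>x. LINT u|M. g x u"
  have "(?F \<longlongrightarrow> ?F x) (nhds x)" for x
  proof (rule ccontr)
    assume "\<not> (?F \<longlongrightarrow> ?F x) (nhds x)"
    then obtain e where e: "e > 0" "\<not> (\<forall>\<^sub>F y in nhds x. dist (?F y) (?F x) < e)"
      by (auto simp: tendsto_iff)
    then have far: "\<exists>y\<in>U. e \<le> dist (?F y) (?F x)" if "open U" "x \<in> U" for U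
      using that by (fastforce simp: eventually_nhds not_less)
    obtain B where B: "countable B" "\<And>V. V \<in> B \<Longrightarrow> open V"
      "\<And>U. open U \<Longrightarrow> x \<in> U \<Longrightarrow> \<exists>V\<in>B. x \<in> V \<and> V \<subseteq> U"
      using fc unfolding first_countable_def by simp metis
    define B' where "B' = {V \<in> B. x \<in> V}"
    have B': "countable B'" "\<And>V. V \<in> B' \<Longrightarrow> open V \<and> x \<in> V"
      "\<And>U. open U \<Longrightarrow> x \<in> U \<Longrightarrow> \<exists>V\<in>B'. V \<subseteq> U"
      using B(1,2) by (auto simp: B'_def) (use B(3) in blast)
    then have "B' \<noteq> {}"
      using open_UNIV by blast
    define U where "U n = (\<Inter>i\<le>n. from_nat_into B' i)" for n :: nat
    have "open (U n) \<and> x \<in> U n" for n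
      using B'(2) from_nat_into[OF \<open>B' \<noteq> {}\<close>] by (auto simp: U_def)
    then have "\<exists>y. y \<in> U n \<and> e \<le> dist (?F y) (?F x)" for n
      using far[of "U n"] by auto
    then obtain y where y: "\<And>n. y n \<in> U n" "\<And>n. e \<le> dist (?F (y n)) (?F x)"
      by metis
    have "y \<longlonglongrightarrow> x"
    proof (rule topological_tendstoI)
      fix S assume "open S" "x \<in> S"
      then obtain V where V: "V \<in> B'" "V \<subseteq> S"
        using B'(3) by blast
      then obtain m where "from_nat_into B' m = V"
        using from_nat_into_surj[OF B'(1)] by blast
      then have "y n \<in> S" if "n \<ge> m" for n
        using y(1)[of n] that V(2) by (auto simp: U_def)
      then show "\<forall>\<^sub>F n in sequentially. y n \<in> S"
        by (auto simp: eventually_sequentially)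
    qed
    have "(\<lambda>n. ?F (y n)) \<longlonglongrightarrow> ?F x"
    proof (rule integral_dominated_convergence[OF meas meas w])
      show "AE u in M. (\<lambda>n. g (y n) u) \<longlonglongrightarrow> g x u"
        using continuous_on_tendsto_compose[OF cont \<open>y \<longlonglongrightarrow> x\<close>] by (intro AE_I2) auto
    qed (use bound in auto)
    then have "\<forall>\<^sub>F n in sequentially. dist (?F (y n)) (?F x) < e"
      using e(1) by (rule tendstoD)
    then show False
      using y(2) by (auto simp: eventually_sequentially not_less[symmetric])
  qed
  then show ?thesis
    by (auto simp: continuous_on_def intro: tendsto_mono[OF at_within_le_nhds])
qed

text \<open>This is inner regularity applied to the whole space, whose mass is finite.\<close>

lemma bounded_Radon_measure_compact_exhaustion:
  assumes "bounded_Radon_measure T M" and "\<delta> > 0"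
  obtains K where "K \<in> sets M" "compactin T K" "measure M (space M - K) < \<delta>"
  \<comment> \<open>When the total mass is below \<open>\<delta>\<close>, subtracting \<open>\<delta>\<close> gives a negative number, which
    the conversion to \<^typ>\<open>ennreal\<close> would truncate; the empty set serves in this case.\<close>
proof (cases "measure M (space M) < \<delta>")
  case True
  then show ?thesis
    using that[of "{}"] by simp
next
  case False
  interpret finite_measure M
    using assms(1) unfolding bounded_Radon_measure_def by blast
  let ?\<K> = "{K \<in> sets M. compactin T K \<and> K \<subseteq> space M}"
  have "ennreal (measure M (space M) - \<delta>) < emeasure M (space M)"
    using assms(2) False by (simp add: emeasure_eq_measure ennreal_less_iff)
  also have "\<dots> = (SUP K\<in>?\<K>. emeasure M K)"
    using assms(1) unfolding bounded_Radon_measure_def by blast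
  finally obtain K where K: "K \<in> ?\<K>" "ennreal (measure M (space M) - \<delta>) < emeasure M K"
    by (auto simp: less_SUP_iff)
  then have "measure M (space M) - \<delta> < measure M K"
    using False by (simp add: emeasure_eq_measure ennreal_less_iff)
  then have "measure M (space M - K) < \<delta>"
    using K(1) by (simp add: finite_measure_compl)
  then show ?thesis
    using that K(1) by blast
qed

text \<open>Off a compact set \<open>K\<close> of almost full measure, the variation of \<open>g\<close> is at most twice its bound.
  On \<open>K\<close> the tube lemma gives one neighbourhood of \<open>x\<close> on which all \<open>g y u\<close> with \<open>u \<in> K\<close> are
  close to \<open>g x u\<close>; compactness of \<open>K\<close> thus replaces the passage to sequences.\<close>

lemma continuous_on_integral_bounded_Radon:
  fixes g :: "'x::topological_space \<Rightarrow> 'w \<Rightarrow> 'b::{banach, second_countable_topology}"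
  assumes Radon: "bounded_Radon_measure T M"
    and meas: "\<And>x. g x \<in> borel_measurable M"
    and cont: "continuous_map (prod_topology T euclidean) euclidean (\<lambda>(u, x). g x u)"
    and bound: "\<And>x u. u \<in> space M \<Longrightarrow> norm (g x u) \<le> C"
  shows "continuous_on UNIV (\<lambda>x. LINT u|M. g x u)"
proof -
  let ?F = "\<lambda>x. LINT u|M. g x u"
  interpret finite_measure M
    using Radon unfolding bounded_Radon_measure_def by blast
  have space: "space M = topspace T"
    using Radon unfolding bounded_Radon_measure_def by blast
  have int: "integrable M (g x)" for x
    by (rule integrable_const_bound[OF _ meas, of _ C]) (use bound in auto)
  have "(?F \<longlongrightarrow> ?F x) (nhds x)" for x
  proof (rule tendstoI)
    fix e :: real assume "e > 0"
    define D where "D = \<bar>C\<bar>"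
    have D: "D \<ge> 0" "\<And>x u. u \<in> space M \<Longrightarrow> norm (g x u) \<le> D"
      using order_trans[OF bound abs_ge_self] by (auto simp: D_def)
    \<comment> \<open>The integral of the variation of \<open>g\<close> will be at most \<open>\<delta> * measure M (space M) + 2 * D * \<delta>\<close>.\<close>
    define \<delta> where "\<delta> = e / (measure M (space M) + 2 * D + 1)"
    have pos: "measure M (space M) + 2 * D + 1 > 0"
      using D(1) measure_nonneg[of M "space M"] by linarith
    then have "\<delta> > 0"
      using \<open>e > 0\<close> by (simp add: \<delta>_def)
    obtain K where K: "K \<in> sets M" "compactin T K" "measure M (space M - K) < \<delta>"
      using bounded_Radon_measure_compact_exhaustion[OF Radon \<open>\<delta> > 0\<close>] .
    let ?P = "prod_topology T (euclidean :: 'x topology)"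
    have "continuous_map ?P euclidean ((\<lambda>(u, y). g y u) \<circ> (\<lambda>p. (fst p, x)))"
      by (rule continuous_map_compose[OF _ cont])
         (auto intro: continuous_map_pairedI continuous_map_fst)
    then have "continuous_map ?P euclidean (\<lambda>p. (case p of (u, y) \<Rightarrow> g y u) - g x (fst p))"
      by (intro continuous_map_diff cont) (simp add: comp_def)
    note openin_continuous_map_preimage[OF this, of "ball 0 \<delta>"]
    moreover define W where "W = {p \<in> topspace ?P. (case p of (u, y) \<Rightarrow> g y u) - g x (fst p) \<in> ball 0 \<delta>}"
    ultimately have "openin ?P W"
      by (simp only: open_openin[symmetric] open_ball W_def)
    moreover have "K \<times> {x} \<subseteq> W"
      using compactin_subset_topspace[OF K(2)] \<open>\<delta> > 0\<close> by (auto simp: W_def)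
    ultimately obtain U V where UV: "open V" "K \<subseteq> U" "x \<in> V" "U \<times> V \<subseteq> W"
      using tube_lemma_left[OF _ K(2), of euclidean W x] by auto
    have "dist (?F y) (?F x) < e" if "y \<in> V" for y
    proof -
      have close: "norm (g y u - g x u) \<le> \<delta> + 2 * D * indicator (space M - K) u"
        if "u \<in> space M" for u
      proof (cases "u \<in> K")
        case True
        then have "(u, y) \<in> W"
          using UV(2,4) \<open>y \<in> V\<close> by auto
        then show ?thesis
          using True by (simp add: W_def)
      next
        case False
        have "norm (g y u - g x u) \<le> D + D"
          using norm_triangle_ineq4[of "g y u" "g x u"] D(2)[OF that] by (meson add_mono order_trans)
        then show ?thesis
          using False that \<open>\<delta> > 0\<close> by simp
      qed
      have "dist (?F y) (?F x) = norm (LINT u|M. g y u - g x u)"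
        using int by (simp add: dist_norm)
      also have "\<dots> \<le> (LINT u|M. \<delta> + 2 * D * indicator (space M - K) u)"
        using int K(1) close
        by (intro norm_integral_le_integral) (auto simp: emeasure_eq_measure)
      also have "\<dots> = \<delta> * measure M (space M) + 2 * D * measure M (space M - K)"
        using K(1) by (simp add: emeasure_eq_measure)
      also have "\<dots> \<le> \<delta> * (measure M (space M) + 2 * D)"
        using mult_left_mono[of "measure M (space M - K)" \<delta> "2 * D"] D(1) K(3)
        by (simp add: algebra_simps)
      also have "\<dots> < \<delta> * (measure M (space M) + 2 * D + 1)"
        using \<open>\<delta> > 0\<close> by simp
      also have "\<dots> = e"
        using pos by (simp add: \<delta>_def)
      finally show ?thesis .
    qed
    then show "\<forall>\<^sub>F y in nhds x. dist (?F y) (?F x) < e"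
      using UV(1,3) by (auto simp: eventually_nhds)
  qed
  then show ?thesis
    by (auto simp: continuous_on_def intro: tendsto_mono[OF at_within_le_nhds])
qed

section \<open>The Hausdorff operator\<close>

lemma measurable_into_Aut:
  assumes "A \<in> measurable M (borel_of Aut_topology)" and "u \<in> space M"
  shows "A u \<in> Aut"
proof -
  have "A u \<in> topspace Aut_topology"
    using measurable_space[OF assms] by (simp add: borel_of_def space_measure_of_conv)
  then show ?thesis
    by (auto simp: Aut_topology_def)
qed

lemma continuous_on_automorphism:
  assumes "\<tau> \<in> Aut"
  shows "continuous_on UNIV \<tau>"
  using assms by (auto simp: Aut_def dest: homeomorphic_imp_continuous_map)

text \<open>The automorphisms that send \<open>x\<close> into an open set \<open>V\<close> form a subbasic open set of the
  topology of the automorphism group: take the compact set \<open>{x}\<close>.\<close>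

lemma borel_measurable_eval_automorphism:
  fixes A :: "'w \<Rightarrow> 'g \<Rightarrow> 'g :: topological_ab_group_add"
  assumes A: "A \<in> measurable M (borel_of Aut_topology)"
  shows "(\<lambda>u. A u x) \<in> borel_measurable M"
proof (rule borel_measurableI)
  fix V :: "'g set" assume "open V"
  let ?E = "{\<tau> \<in> Aut. \<tau> ` {x} \<subseteq> V}"
  have "?E \<in> {{\<tau> \<in> Aut. \<tau> ` K \<subseteq> U} |K U. compact K \<and> open U}"
    using \<open>open V\<close> by (intro CollectI exI[of _ "{x}"] exI[of _ V]) simp
  then have "openin Aut_topology ?E"
    unfolding Aut_topology_def by (intro topology_generated_by_Basis UnI1)
  then have "?E \<in> sets (borel_of Aut_topology)"
    using openin_subset by (subst borel_of_def, subst sets_measure_of) blast+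
  then have "A -` ?E \<inter> space M \<in> sets M"
    using A by (rule measurable_sets[rotated])
  also have "A -` ?E \<inter> space M = (\<lambda>u. A u x) -` V \<inter> space M"
    using measurable_into_Aut[OF A] by auto
  finally show "(\<lambda>u. A u x) -` V \<inter> space M \<in> sets M" .
qed

lemma integrable_hausdorff_integrand:
  fixes A :: "'w \<Rightarrow> 'g \<Rightarrow> 'g :: topological_ab_group_add" and f :: "'g \<Rightarrow> complex"
  assumes A: "A \<in> measurable M (borel_of Aut_topology)"
    and \<Phi>: "integrable M \<Phi>"
    and f: "continuous_on UNIV f" and B: "\<And>y. norm (f y) \<le> B"
  shows "integrable M (\<lambda>u. \<Phi> u * f (A u x))"
proof (rule Bochner_Integration.integrable_bound)
  show "integrable M (\<lambda>u. norm (\<Phi> u) * B)"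
    using \<Phi> by simp
  have "(\<lambda>u. f (A u x)) \<in> borel_measurable M"
    using borel_measurable_continuous_onI[OF f] borel_measurable_eval_automorphism[OF A]
    by measurable
  then show "(\<lambda>u. \<Phi> u * f (A u x)) \<in> borel_measurable M"
    using \<Phi> by measurable
  have "norm (\<Phi> u * f (A u x)) \<le> norm (norm (\<Phi> u) * B)" for u
    using mult_left_mono[OF order_trans[OF B abs_ge_self], of "norm (\<Phi> u)"]
    by (simp add: norm_mult abs_mult)
  then show "AE u in M. norm (\<Phi> u * f (A u x)) \<le> norm (norm (\<Phi> u) * B)"
    by simp
qed

lemma norm_hausdorff_op_le:
  assumes "integrable M \<Phi>" and "integrable M (\<lambda>u. \<Phi> u * f (A u x))"
    and "\<And>y. norm (f y) \<le> B"
  shows "norm (hausdorff_op M \<Phi> A f x) \<le> (LINT u|M. norm (\<Phi> u)) * B"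
proof -
  have "norm (hausdorff_op M \<Phi> A f x) \<le> (LINT u|M. norm (\<Phi> u) * B)"
    unfolding hausdorff_op_def
  proof (rule norm_integral_le_integral)
    show "norm (\<Phi> u * f (A u x)) \<le> norm (\<Phi> u) * B" for u
      unfolding norm_mult by (rule mult_left_mono[OF assms(3) norm_ge_zero])
  qed (use assms(1,2) in auto)
  then show ?thesis
    by simp
qed

text \<open>The operator is tested on the constant function \<open>1\<close>.\<close>

lemma integrable_if_hausdorff_acts_in_C:
  fixes A :: "'w \<Rightarrow> 'g \<Rightarrow> 'g :: topological_space"
  assumes "hausdorff_acts_in_C M \<Phi> A"
  shows "integrable M \<Phi>"
proof -
  have "integrable M (\<lambda>u. \<Phi> u * (\<lambda>_. 1) (A u x))" for x :: 'g
    using assms unfolding hausdorff_acts_in_C_def by (blast intro: continuous_on_const)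
  then show ?thesis
    by simp
qed

text \<open>Once the operator preserves continuity, boundedness is automatic: \<open>\<Phi>\<close> is then integrable, and
  integrating the pointwise bound shows that values of \<^const>\<open>hausdorff_op\<close> lie in
  \<^const>\<open>bcontfun\<close>, so that \<^const>\<open>Bcontfun\<close> may be inverted.\<close>

lemma hausdorff_C_bounded_linear:
  fixes A :: "'w \<Rightarrow> 'g \<Rightarrow> 'g :: topological_space"
  assumes acts: "hausdorff_acts_in_C M \<Phi> A"
  shows "bounded_linear (hausdorff_C M \<Phi> A)"
    and "onorm (hausdorff_C M \<Phi> A) \<le> (LINT u|M. norm (\<Phi> u))"
proof -
  let ?L = "LINT u|M. norm (\<Phi> u)"
  have \<Phi>: "integrable M \<Phi>"
    using acts by (rule integrable_if_hausdorff_acts_in_C)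
  have int: "integrable M (\<lambda>u. \<Phi> u * f (A u x))" for f :: "'g \<Rightarrow>\<^sub>C complex" and x
    using acts by (auto simp: hausdorff_acts_in_C_def)
  have le: "norm (hausdorff_op M \<Phi> A f x) \<le> ?L * norm f" for f :: "'g \<Rightarrow>\<^sub>C complex" and x
    by (intro norm_hausdorff_op_le \<Phi> int norm_bounded)
  have "hausdorff_op M \<Phi> A f \<in> bcontfun" for f :: "'g \<Rightarrow>\<^sub>C complex"
    using acts le[of f] by (auto simp: bcontfun_def hausdorff_acts_in_C_def bounded_iff)
  then have app: "apply_bcontfun (hausdorff_C M \<Phi> A f) = hausdorff_op M \<Phi> A f"
    for f :: "'g \<Rightarrow>\<^sub>C complex"
    by (simp add: hausdorff_C_def Bcontfun_inverse)
  have norm_le: "norm (hausdorff_C M \<Phi> A f) \<le> ?L * norm f" for f :: "'g \<Rightarrow>\<^sub>C complex"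
    using le by (auto intro!: norm_bound simp: app)
  show "bounded_linear (hausdorff_C M \<Phi> A)"
  proof (rule bounded_linear_intro)
    show "hausdorff_C M \<Phi> A (f + h) = hausdorff_C M \<Phi> A f + hausdorff_C M \<Phi> A h" for f h
      by (rule bcontfun_eqI) (simp add: app hausdorff_op_def distrib_left int)
    show "hausdorff_C M \<Phi> A (r *\<^sub>R f) = r *\<^sub>R hausdorff_C M \<Phi> A f" for r f
      by (rule bcontfun_eqI) (simp add: app hausdorff_op_def)
    show "norm (hausdorff_C M \<Phi> A f) \<le> norm f * ?L" for f
      using norm_le by (simp add: mult.commute)
  qed
  show "onorm (hausdorff_C M \<Phi> A) \<le> ?L"
    using norm_le by (intro onorm_bound) auto
qed

theorem proposition2:
  fixes M :: "'w measure"
    and T :: "'w topology"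
    and \<Phi> :: "'w \<Rightarrow> complex"
    and A :: "'w \<Rightarrow> 'g \<Rightarrow> 'g :: {topological_ab_group_add, t2_space}"
  assumes "compact (UNIV :: 'g set)"
    and "A \<in> measurable M (borel_of Aut_topology)"
    and "locally_integrable M \<Phi>"
    and "first_countable (euclidean :: 'g topology) \<or>
      (completely_regular_space T \<and> bounded_Radon_measure T M \<and>
       continuous_map T euclidean \<Phi> \<and> bounded (\<Phi> ` topspace T) \<and>
       continuous_map (prod_topology T euclidean) euclidean (\<lambda>(u, x). A u x))"
  shows "(hausdorff_acts_in_C M \<Phi> A \<and> bounded_linear (hausdorff_C M \<Phi> A) \<longleftrightarrow> integrable M \<Phi>) \<and>
    (integrable M \<Phi> \<longrightarrow> onorm (hausdorff_C M \<Phi> A) \<le> (LINT u|M. norm (\<Phi> u)))"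
proof -
  have "hausdorff_acts_in_C M \<Phi> A" if \<Phi>: "integrable M \<Phi>"
    unfolding hausdorff_acts_in_C_def
  proof (intro allI impI conjI)
    fix f :: "'g \<Rightarrow> complex"
    assume f: "continuous_on UNIV f"
    then obtain B where B: "\<And>y. norm (f y) \<le> B"
      using compact_imp_bounded[OF compact_continuous_image[OF f assms(1)]]
      by (auto simp: bounded_iff)
    show int: "integrable M (\<lambda>u. \<Phi> u * f (A u x))" for x
      by (rule integrable_hausdorff_integrand[OF assms(2) \<Phi> f B])
    then have meas: "(\<lambda>u. \<Phi> u * f (A u x)) \<in> borel_measurable M" for x
      by (rule borel_measurable_integrable)
    have bound: "norm (\<Phi> u * f (A u x)) \<le> norm (\<Phi> u) * B" for u x
      unfolding norm_mult by (rule mult_left_mono[OF B norm_ge_zero])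
    have "continuous_on UNIV (\<lambda>x. LINT u|M. \<Phi> u * f (A u x))"
      using assms(4)
    proof (elim disjE conjE)
      assume fc: "first_countable (euclidean :: 'g topology)"
      show ?thesis
      proof (rule continuous_on_integral_first_countable[OF fc meas _ _ bound])
        fix u assume "u \<in> space M"
        then have "continuous_on UNIV (A u)"
          by (intro continuous_on_automorphism measurable_into_Aut[OF assms(2)])
        then show "continuous_on UNIV (\<lambda>x. \<Phi> u * f (A u x))"
          using f by (intro continuous_intros continuous_on_compose2[OF f]) auto
      qed (use \<Phi> in simp)
    next
      let ?P = "prod_topology T (euclidean :: 'g topology)"
      assume Radon: "bounded_Radon_measure T M"
        and \<Phi>_cont: "continuous_map T euclidean \<Phi>" and \<Phi>_bdd: "bounded (\<Phi> ` topspace T)"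
        and A_cont: "continuous_map ?P euclidean (\<lambda>(u, x). A u x)"
      obtain C where C: "\<And>u. u \<in> space M \<Longrightarrow> norm (\<Phi> u) \<le> C"
        using \<Phi>_bdd Radon unfolding bounded_iff bounded_Radon_measure_def by (metis imageI)
      have "B \<ge> 0"
        using B[of 0] norm_ge_zero order_trans by blast
      show ?thesis
      proof (rule continuous_on_integral_bounded_Radon[OF Radon meas])
        have "continuous_map ?P euclidean (\<lambda>p. \<Phi> (fst p))"
          using continuous_map_compose[OF continuous_map_fst \<Phi>_cont] by (simp add: comp_def)
        moreover have "continuous_map ?P euclidean (\<lambda>p. f (A (fst p) (snd p)))"
          using continuous_map_compose[OF A_cont, of euclidean f] f
          by (simp add: comp_def case_prod_beta)
        ultimately show "continuous_map ?P euclidean (\<lambda>(u, x). \<Phi> u * f (A u x))"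
          unfolding case_prod_beta continuous_map_atin limitin_canonical_iff
          by (intro ballI tendsto_mult) blast+
        show "norm (\<Phi> u * f (A u x)) \<le> C * B" if "u \<in> space M" for x u
          using order_trans[OF bound mult_right_mono[OF C[OF that] \<open>B \<ge> 0\<close>]] .
      qed
    qed
    then show "continuous_on UNIV (hausdorff_op M \<Phi> A f)"
      by (simp add: hausdorff_op_def[abs_def])
  qed
  then show ?thesis
    using integrable_if_hausdorff_acts_in_C hausdorff_C_bounded_linear by blast
qed

end
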